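(* For every integer $d \geq 2$ we have $$C_{f_{\sum}}^d = \frac{d^2-1}{3},$$ where for a continuous function $f\colon[0,1]^d\to\mathbb{R}$ $$C_f^d = \sup_{\vartheta \in \mathcal{P}_{\mathrm{ds}}([0,1]^d)} \int_{[0,1]^d} f \, \mathrm{d}\vartheta .$$
   Context: A Borel probability measure $\vartheta$ on $[0,1]^d$ is called $d$-stochastic if all its univariate marginals (push-forwards under the coordinate projections) equal the Lebesgue measure $\lambda$ on $[0,1]$. $\mathcal{P}_{\mathrm{ds}}([0,1]^d)$ denotes the set of all $d$-stochastic measures on $[0,1]^d$. Write $[d]=\{1,\ldots,d\}$. The function $f_{\sum}\colon[0,1]^d\to[0,\infty)$ is defined by $f_{\sum}(x_1,\ldots,x_d)=\sum_{i,j\in[d]}|x_i-x_j|$ (sum over all ordered pairs $(i,j)\in[d]^2$). *)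

theory Defs
  imports "HOL-Probability.Probability"
begin

text \<open>The dimension is the cardinality of the finite index type \<open>'n\<close>.\<close>

definition unit_cube :: "(real ^ 'n) set" where
  "unit_cube = {x. \<forall>i. x $ i \<in> {0..1}}"

text \<open>The Lebesgue measure on \<open>[0,1]\<close> is taken on the Borel sets, so both sides of the
  marginal condition are measures on the same sigma-algebra.\<close>

definition d_stochastic :: "(real ^ 'n) measure \<Rightarrow> bool" where
  "d_stochastic \<theta> \<longleftrightarrow>
     prob_space \<theta> \<and>
     sets \<theta> = sets (restrict_space borel unit_cube) \<and>
     (\<forall>i. distr \<theta> (restrict_space borel {0..1}) (\<lambda>x. x $ i) = restrict_space lborel {0..1})"

text \<open>Meant for \<open>f\<close> continuous on the cube, where the integrals exist and are bounded, so that
  the real-valued supremum is the mathematical one. Values of \<open>f\<close> outside the cube are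
  irrelevant.\<close>

definition C :: "(real ^ 'n \<Rightarrow> real) \<Rightarrow> real" where
  "C f = (SUP \<theta> \<in> {\<theta>. d_stochastic \<theta>}. \<integral>x. f x \<partial>\<theta>)"

definition f_sum :: "real ^ 'n \<Rightarrow> real" where
  "f_sum x = (\<Sum>i\<in>UNIV. \<Sum>j\<in>UNIV. \<bar>x $ i - x $ j\<bar>)"

end

theory Submission
  imports Defs
begin

text \<open>
  Write \<open>d\<close> for the number of coordinates. Everything rests on multi-marginal Kantorovich
  duality: if \<open>f_sum x\<close> is at most \<open>(\<Sum>i. g (x $ i)) + c\<close> on the cube, then the integral of the
  right-hand side is the same for all \<open>d\<close>-stochastic measures, since it sees only the marginals.
  A single \<open>d\<close>-stochastic measure supported where the two sides agree is then optimal, and the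
  supremum is the integral of \<open>f_sum\<close> against it.

  The function \<open>g\<close> comes from sorting. If \<open>r i \<in> {0..<d}\<close> is the rank of coordinate \<open>i\<close>, then
  \<open>f_sum x\<close> is the sum of \<open>2 * (2 * r i + 1 - d) * x $ i\<close> (\<open>f_sum_rank\<close>): each coordinate
  is multiplied by a slope that depends on its rank alone. Let \<open>g\<close> be the convex, piecewise linear
  function with slope \<open>2 * (2 * k + 1 - d)\<close> on \<open>[k/d, (k+1)/d]\<close>; it is the upper envelope of its
  lines, so the line of slope number \<open>r i\<close> bounds the \<open>i\<close>-th summand, and since the ranks run
  through \<open>{0..<d}\<close> the intercepts add up to a constant (\<open>f_sum_le_potential\<close>). Equality
  holds when exactly one coordinate falls into each of the \<open>d\<close> intervals
  (\<open>f_sum_eq_potential\<close>).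

  The optimal measure is the law of \<open>(frac (U + e i / d))\<^sub>i\<close> with \<open>U\<close> uniform and \<open>e\<close> an
  enumeration of the coordinates. Rotations of the circle preserve Lebesgue measure, so it is
  \<open>d\<close>-stochastic (\<open>d_stochastic_cyclic\<close>). Its points have coordinates
  \<open>(k + t) / d\<close>, one for each \<open>k < d\<close>, with a common \<open>t \<in> [0,1)\<close>. Hence the duality inequality
  is an equality on its support, and moreover \<open>f_sum\<close> is constantly
  \<open>(d\<^sup>2 - 1) / 3\<close> there (\<open>f_sum_equispaced\<close>), so that the integral of \<open>g\<close> never has to be
  computed.
\<close>

section \<open>The pairwise distance sum in terms of ranks\<close>

text \<open>Ties in \<open>h\<close> are broken arbitrarily, hence only one implication between ranks and values.\<close>

lemma rank_exists:
  fixes h :: "'n::finite \<Rightarrow> 'a::linorder"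
  shows "\<exists>r. bij_betw r UNIV {..<CARD('n)} \<and> (\<forall>i j. r i < r j \<longrightarrow> h i \<le> h j)"
proof -
  obtain l :: "'n list" where l: "set l = UNIV" "distinct l"
    using finite_distinct_list[of "UNIV :: 'n set"] by auto
  define xs where "xs = sort_key h l"
  have xs: "set xs = UNIV" "distinct xs" "sorted (map h xs)"
    using l by (auto simp: xs_def)
  have len: "length xs = CARD('n)"
    using xs distinct_card by metis
  have bij: "bij_betw ((!) xs) {..<CARD('n)} UNIV"
    using bij_betw_nth[of xs "{..<CARD('n)}" UNIV] xs len by simp
  define r where "r = inv_into {..<CARD('n)} ((!) xs)"
  have r: "bij_betw r UNIV {..<CARD('n)}"
    unfolding r_def by (rule bij_betw_inv_into[OF bij])
  have nth: "xs ! r i = i" for i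
    unfolding r_def using bij by (auto simp: bij_betw_def intro!: f_inv_into_f)
  have lt: "r i < CARD('n)" for i
    using r by (auto simp: bij_betw_def)
  have "h i \<le> h j" if "r i < r j" for i j
    using sorted_nth_mono[OF xs(3), of "r i" "r j"] that lt[of i] lt[of j] len nth[of i] nth[of j] by simp
  with r show ?thesis by blast
qed

lemma sum_sgn_rank:
  fixes m d :: nat
  assumes "m < d"
  shows "(\<Sum>k<d. sgn (real m - real k)) = 2 * real m + 1 - real d"
proof -
  have "(\<Sum>k<d. sgn (real m - real k)) = (if d \<le> m then real d else 2 * real m + 1 - real d)"
    by (induction d) (auto simp: sgn_if)
  with assms show ?thesis by simp
qed

text \<open>A coordinate enters positively once for each coordinate below it and negatively once for each
  above it. The order hypothesis is the weak one, so that points with equal coordinates are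
  covered: their terms cancel whichever way the tie is broken.\<close>

lemma f_sum_rank:
  fixes x :: "real ^ 'n"
  assumes r: "bij_betw r UNIV {..<CARD('n)}"
    and mono: "\<And>i j. r i < r j \<Longrightarrow> x $ i \<le> x $ j"
  shows "f_sum x = (\<Sum>i\<in>UNIV. 2 * (2 * real (r i) + 1 - real CARD('n)) * x $ i)"
proof -
  define s where "s i j = sgn (real (r i) - real (r j))" for i j
  have abs: "\<bar>x $ i - x $ j\<bar> = s i j * x $ i + s j i * x $ j" for i j
  proof (cases "r i" "r j" rule: linorder_cases)
    case equal
    then have "i = j" using r by (auto simp: bij_betw_def inj_on_def)
    then show ?thesis by (simp add: s_def)
  qed (use mono[of i j] mono[of j i] in \<open>auto simp: s_def sgn_if\<close>)
  have inner: "(\<Sum>j\<in>UNIV. s i j) = 2 * real (r i) + 1 - real CARD('n)" for i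
  proof -
    have "(\<Sum>j\<in>UNIV. s i j) = (\<Sum>k<CARD('n). sgn (real (r i) - real k))"
      unfolding s_def by (rule sum.reindex_bij_betw[OF r])
    also have "\<dots> = 2 * real (r i) + 1 - real CARD('n)"
      using r by (intro sum_sgn_rank) (auto simp: bij_betw_def)
    finally show ?thesis .
  qed
  have "f_sum x = (\<Sum>i\<in>UNIV. \<Sum>j\<in>UNIV. s i j * x $ i) + (\<Sum>i\<in>UNIV. \<Sum>j\<in>UNIV. s j i * x $ j)"
    by (simp add: f_sum_def abs sum.distrib)
  also have "(\<Sum>i\<in>UNIV. \<Sum>j\<in>UNIV. s j i * x $ j) = (\<Sum>i\<in>UNIV. \<Sum>j\<in>UNIV. s i j * x $ i)"
    by (rule sum.swap)
  also have "(\<Sum>i\<in>UNIV. \<Sum>j\<in>UNIV. s i j * x $ i)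
      = (\<Sum>i\<in>UNIV. (2 * real (r i) + 1 - real CARD('n)) * x $ i)"
    by (simp add: inner flip: sum_distrib_right)
  also have "(\<Sum>i\<in>UNIV. (2 * real (r i) + 1 - real CARD('n)) * x $ i)
      + (\<Sum>i\<in>UNIV. (2 * real (r i) + 1 - real CARD('n)) * x $ i)
      = (\<Sum>i\<in>UNIV. 2 * (2 * real (r i) + 1 - real CARD('n)) * x $ i)"
    by (simp add: algebra_simps flip: sum.distrib)
  finally show ?thesis .
qed

section \<open>The dual potential\<close>

text \<open>This is the piecewise linear interpolation of \<open>y\<^sup>2\<close> at the integers: on \<open>[k, k+1]\<close> it is the
  chord through \<open>(k, k\<^sup>2)\<close> and \<open>(k+1, (k+1)\<^sup>2)\<close>.\<close>

definition sq_interp :: "real \<Rightarrow> real" where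
  "sq_interp y = (2 * of_int \<lfloor>y\<rfloor> + 1) * y - of_int \<lfloor>y\<rfloor> * (of_int \<lfloor>y\<rfloor> + 1)"

text \<open>By convexity, extending a chord never goes above the interpolation. Concretely, with
  \<open>n = \<lfloor>y\<rfloor> - k\<close> and \<open>t = frac y\<close> the difference is \<open>n * (n + (2 * t - 1))\<close>, which is
  nonnegative because \<open>n\<close> is an integer and \<open>\<bar>2 * t - 1\<bar> \<le> 1\<close>.\<close>

lemma sq_interp_ge_chord:
  fixes k :: int
  shows "(2 * of_int k + 1) * y - of_int k * (of_int k + 1) \<le> sq_interp y"
proof -
  define n t where "n = \<lfloor>y\<rfloor> - k" and "t = frac y"
  have y: "y = of_int k + of_int n + t" and k: "\<lfloor>y\<rfloor> = k + n"
    by (simp_all add: n_def t_def frac_def)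
  have t: "0 \<le> t" "t < 1" by (auto simp: t_def frac_lt_1)
  have "0 \<le> real_of_int n * (of_int n + (2 * t - 1))"
  proof (cases "n \<ge> 1")
    case True
    then show ?thesis using t by (intro mult_nonneg_nonneg) linarith+
  next
    case False
    show ?thesis
    proof (cases "n = 0")
      case False
      with \<open>\<not> n \<ge> 1\<close> have "n \<le> -1" by simp
      then show ?thesis using t by (intro mult_nonpos_nonpos) linarith+
    qed simp
  qed
  also have "\<dots> = sq_interp y - ((2 * of_int k + 1) * y - of_int k * (of_int k + 1))"
    unfolding sq_interp_def k by (simp add: y algebra_simps)
  finally show ?thesis by simp
qed

text \<open>Rescaling \<open>sq_interp\<close> by \<open>d\<close> puts the breakpoints at multiples of \<open>1 / d\<close> and gives slope
  \<open>2 * (2 * k + 1)\<close> on \<open>[k/d, (k+1)/d]\<close>; the linear term lowers it to the slope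
  \<open>2 * (2 * k + 1 - d)\<close> of the coordinate of rank \<open>k\<close>.\<close>

definition potential :: "nat \<Rightarrow> real \<Rightarrow> real" where
  "potential d x = 2 / real d * sq_interp (real d * x) - 2 * real d * x"

text \<open>The \<open>k\<close>-th summand is minus the intercept of the affine piece of \<open>potential d\<close> on
  \<open>[k/d, (k+1)/d]\<close>.\<close>

definition dual_const :: "nat \<Rightarrow> real" where
  "dual_const d = (\<Sum>k<d. 2 / real d * (real k * (real k + 1)))"

lemma potential_ge_line:
  fixes k d :: nat
  assumes "d > 0"
  shows "2 * (2 * real k + 1 - real d) * x \<le> potential d x + 2 / real d * (real k * (real k + 1))"
proof -
  have "2 / real d * ((2 * real k + 1) * (real d * x) - real k * (real k + 1))
      \<le> 2 / real d * sq_interp (real d * x)"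
    using sq_interp_ge_chord[of "int k" "real d * x"] by (intro mult_left_mono) auto
  then show ?thesis using assms by (simp add: potential_def field_simps)
qed

lemma potential_eq_line:
  fixes k d :: nat
  assumes "d > 0" "\<lfloor>real d * x\<rfloor> = int k"
  shows "2 * (2 * real k + 1 - real d) * x = potential d x + 2 / real d * (real k * (real k + 1))"
  using assms by (simp add: potential_def sq_interp_def field_simps)

text \<open>Each summand of the rank formula is bounded by the line of its own rank; the ranks being a
  permutation of \<open>{..<d}\<close>, the intercepts sum to a constant independent of \<open>x\<close>.\<close>

lemma f_sum_le_potential:
  fixes x :: "real ^ 'n"
  shows "f_sum x \<le> (\<Sum>i\<in>UNIV. potential CARD('n) (x $ i)) + dual_const CARD('n)"
proof -
  obtain r where r: "bij_betw r UNIV {..<CARD('n)}" "\<And>i j. r i < r j \<Longrightarrow> x $ i \<le> x $ j"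
    using rank_exists[of "\<lambda>i. x $ i"] by blast
  have "f_sum x \<le> (\<Sum>i\<in>UNIV. potential CARD('n) (x $ i)
      + 2 / real CARD('n) * (real (r i) * (real (r i) + 1)))"
    by (subst f_sum_rank[OF r(1)]) (blast intro: r(2), intro sum_mono potential_ge_line, simp)
  also have "\<dots> = (\<Sum>i\<in>UNIV. potential CARD('n) (x $ i)) + dual_const CARD('n)"
    unfolding sum.distrib dual_const_def
    by (subst sum.reindex_bij_betw[OF r(1), symmetric]) simp
  finally show ?thesis .
qed

text \<open>With one coordinate in each interval \<open>[k/d, (k+1)/d)\<close>, the interval number is the rank, and
  every coordinate sits on the piece of the potential that belongs to its rank.\<close>

lemma f_sum_eq_potential:
  fixes x :: "real ^ 'n"
  assumes r: "bij_betw r UNIV {..<CARD('n)}"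
    and fl: "\<And>i. \<lfloor>real CARD('n) * x $ i\<rfloor> = int (r i)"
  shows "f_sum x = (\<Sum>i\<in>UNIV. potential CARD('n) (x $ i)) + dual_const CARD('n)"
proof -
  have mono: "x $ i \<le> x $ j" if "r i < r j" for i j
  proof -
    have "real CARD('n) * x $ i < real CARD('n) * x $ j"
      by (rule floor_less_cancel) (use that fl in simp)
    then show ?thesis by simp
  qed
  have "f_sum x = (\<Sum>i\<in>UNIV. potential CARD('n) (x $ i)
      + 2 / real CARD('n) * (real (r i) * (real (r i) + 1)))"
    by (subst f_sum_rank[OF r]) (blast intro: mono, intro sum.cong refl potential_eq_line fl, simp)
  also have "\<dots> = (\<Sum>i\<in>UNIV. potential CARD('n) (x $ i)) + dual_const CARD('n)"
    unfolding sum.distrib dual_const_def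
    by (subst sum.reindex_bij_betw[OF r, symmetric]) simp
  finally show ?thesis .
qed

text \<open>Only differences matter, so \<open>t\<close> drops out and the value is
  \<open>(\<Sum>k<d. \<Sum>l<d. \<bar>k - l\<bar>) / d\<close>.\<close>

lemma f_sum_equispaced:
  fixes x :: "real ^ 'n"
  assumes r: "bij_betw r UNIV {..<CARD('n)}"
    and x: "\<And>i. real CARD('n) * x $ i = real (r i) + t"
  shows "f_sum x = ((real CARD('n))\<^sup>2 - 1) / 3"
proof -
  let ?d = "real CARD('n)"
  have xi: "x $ i = (real (r i) + t) / ?d" for i
    using x[of i] by (simp add: field_simps)
  \<comment> \<open>The slope offset \<open>c\<close> is kept apart from the length \<open>m\<close>, so that the induction leaves it fixed;
    for \<open>c = m\<close> the coefficient of \<open>t\<close> vanishes.\<close>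
  have poly: "3 * (\<Sum>k<m. (2 * real k + 1 - c) * (real k + t))
      = (2 * real m * (real m - 1) * (2 * real m - 1)) / 2 + 3 * (1 - c + 2 * t) * (real m * (real m - 1)) / 2
        + 3 * (1 - c) * t * real m" for m c
    by (induction m) (auto simp: field_simps)
  have "f_sum x = (\<Sum>i\<in>UNIV. 2 / ?d * ((2 * real (r i) + 1 - ?d) * (real (r i) + t)))"
    by (subst f_sum_rank[OF r]) (simp_all add: xi divide_right_mono mult_ac)
  also have "\<dots> = (\<Sum>k<CARD('n). 2 / ?d * ((2 * real k + 1 - ?d) * (real k + t)))"
    by (rule sum.reindex_bij_betw[OF r])
  also have "\<dots> = 2 / (3 * ?d) * (3 * (\<Sum>k<CARD('n). (2 * real k + 1 - ?d) * (real k + t)))"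
    by (simp add: sum_distrib_left mult_ac)
  also have "\<dots> = (?d\<^sup>2 - 1) / 3"
    unfolding poly by (simp add: field_simps power2_eq_square)
  finally show ?thesis .
qed

section \<open>The cyclic coupling\<close>

abbreviation unif :: "real measure" where "unif \<equiv> restrict_space lborel {0..1}"

lemma prob_space_unif: "prob_space unif"
  by (rule prob_spaceI) (simp add: emeasure_restrict_space space_restrict_space)

lemma borel_measurable_frac_shift [measurable]: "(\<lambda>u::real. frac (u + a)) \<in> borel_measurable borel"
  unfolding frac_def by measurable

text \<open>Rotation of the circle preserves Lebesgue measure: it translates \<open>[0, 1 - a)\<close> onto \<open>[a, 1)\<close> and
  \<open>[1 - a, 1)\<close> onto \<open>[0, a)\<close>. The endpoint \<open>1\<close>, where the rotation of the closed interval is not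
  one of these translations, is discarded as a null set.\<close>

lemma distr_frac_shift:
  assumes a: "0 \<le> a" "a < 1"
  shows "distr unif (restrict_space borel {0..1}) (\<lambda>u. frac (u + a)) = unif"
proof (rule measure_eqI)
  show "sets (distr unif (restrict_space borel {0..1}) (\<lambda>u. frac (u + a))) = sets unif"
    by (simp add: sets_restrict_space)
  have meas: "(\<lambda>u. frac (u + a)) \<in> unif \<rightarrow>\<^sub>M restrict_space borel {0..1}"
    by (intro measurable_restrict_space2 measurable_restrict_space1)
       (auto simp: frac_lt_1 less_imp_le)
  fix A assume "A \<in> sets (distr unif (restrict_space borel {0..1}) (\<lambda>u. frac (u + a)))"
  then have A': "A \<in> sets (restrict_space borel {0..1::real})" by simp
  then have A[measurable]: "A \<in> sets borel" and sub: "A \<subseteq> {0..1}"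
    by (auto simp: sets_restrict_space_iff)
  define B where "B = (\<lambda>u. frac (u + a)) -` A \<inter> {0..<1}"
  have B[measurable]: "B \<in> sets borel" 
    unfolding B_def by measurable
  have shift: "emeasure lborel ((+) c -` S) = emeasure lborel S" if "S \<in> sets borel" for S and c :: real
    using lborel_distr_plus[of c] emeasure_distr[of "(+) c" lborel borel S] that by simp
  have "emeasure (distr unif (restrict_space borel {0..1}) (\<lambda>u. frac (u + a))) A
      = emeasure lborel ((\<lambda>u. frac (u + a)) -` A \<inter> {0..1})"
    using A' by (subst emeasure_distr[OF meas])
      (auto simp: space_restrict_space emeasure_restrict_space)
  also have "\<dots> = emeasure lborel B"
  proof (rule emeasure_eq_AE)
    show "AE u in lborel. (u \<in> (\<lambda>u. frac (u + a)) -` A \<inter> {0..1}) = (u \<in> B)"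
      using AE_lborel_singleton[of "1::real"] by eventually_elim (auto simp: B_def)
    show "(\<lambda>u. frac (u + a)) -` A \<inter> {0..1} \<in> sets lborel" by measurable
  qed measurable
  also have "B = ((+) a -` (A \<inter> {a..<1})) \<union> ((+) (a - 1) -` (A \<inter> {0..<a}))"
  proof -
    have "frac (u + a) = a + u" if "0 \<le> u" "u + a < 1" for u
      using that a by (simp add: frac_eq)
    moreover have "frac (u + a) = a - 1 + u" if "u < 1" "1 \<le> u + a" for u
      using that a by (intro iffD2[OF frac_unique_iff]) (auto intro!: Ints_1)
    ultimately show ?thesis
      using a by (intro set_eqI, rename_tac u, case_tac "u + a < 1") (auto simp: B_def add_ac)
  qed
  also have "emeasure lborel \<dots> = emeasure lborel ((+) a -` (A \<inter> {a..<1})) + emeasure lborel ((+) (a - 1) -` (A \<inter> {0..<a}))"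
    by (rule plus_emeasure[symmetric]) (use a in \<open>auto\<close>)
  also have "\<dots> = emeasure lborel (A \<inter> {a..<1}) + emeasure lborel (A \<inter> {0..<a})"
    by (subst (1 2) shift) simp_all
  also have "\<dots> = emeasure lborel (A \<inter> {0..<1})"
    by (subst plus_emeasure) (use a in \<open>auto intro!: arg_cong[where f="emeasure lborel"]\<close>)
  also have "\<dots> = emeasure lborel A"
  proof (rule emeasure_eq_AE)
    show "AE u in lborel. (u \<in> A \<inter> {0..<1}) = (u \<in> A)"
      using AE_lborel_singleton[of "1::real"] by eventually_elim (use sub in auto)
  qed measurable
  also have "\<dots> = emeasure unif A"
    using sub by (simp add: emeasure_restrict_space)
  finally show "emeasure (distr unif (restrict_space borel {0..1}) (\<lambda>u. frac (u + a))) A = emeasure unif A" .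
qed


lemma bij_betw_add_mod:
  fixes m d :: nat
  assumes "d > 0"
  shows "bij_betw (\<lambda>k. (m + k) mod d) {..<d} {..<d}"
proof -
  have "inj_on (\<lambda>k. (m + k) mod d) {..<d}"
  proof (rule inj_onI)
    fix k l assume kl: "k \<in> {..<d}" "l \<in> {..<d}" and eq: "(m + k) mod d = (m + l) mod d"
    have "(int m + int k) mod int d = (int m + int l) mod int d"
      using arg_cong[OF eq, of int] by (simp add: of_nat_mod)
    then have "int d dvd int k - int l"
      by (simp add: mod_eq_dvd_iff)
    then have "int k - int l = 0"
      using kl dvd_imp_le_int[of "int k - int l" "int d"] by fastforce
    then show "k = l" by simp
  qed
  moreover have "(\<lambda>k. (m + k) mod d) ` {..<d} \<subseteq> {..<d}"
    using assms by auto
  ultimately show ?thesis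
    by (simp add: bij_betw_def endo_inj_surj)
qed

definition cyclic_point :: "('n \<Rightarrow> nat) \<Rightarrow> real \<Rightarrow> real ^ 'n" where
  "cyclic_point e u = (\<chi> i. frac (u + real (e i) / real CARD('n)))"

text \<open>Writing \<open>d * u = m + t\<close> with \<open>m\<close> the integer part, the coordinate \<open>i\<close> becomes
  \<open>((m + e i) mod d + t) / d\<close>: the remainder \<open>t\<close> is shared by all coordinates, and adding \<open>m\<close>
  modulo \<open>d\<close> permutes the interval numbers.\<close>

lemma cyclic_point_equispaced:
  fixes e :: "'n::finite \<Rightarrow> nat"
  assumes e: "bij_betw e UNIV {..<CARD('n)}" and u: "0 \<le> u"
  obtains r t where "bij_betw r UNIV {..<CARD('n)}" "0 \<le> t" "t < 1"
    "\<And>i. real CARD('n) * cyclic_point e u $ i = real (r i) + t"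
proof -
  let ?d = "CARD('n)"
  define m t where "m = nat \<lfloor>real ?d * u\<rfloor>" and "t = frac (real ?d * u)"
  define r where "r i = (m + e i) mod ?d" for i
  have t: "0 \<le> t" "t < 1" by (auto simp: t_def frac_lt_1)
  have "real m = of_int \<lfloor>real ?d * u\<rfloor>" using u by (simp add: m_def)
  then have du: "real ?d * u = real m + t" by (simp add: t_def frac_def)
  have "bij_betw r UNIV {..<?d}"
    using bij_betw_trans[OF e bij_betw_add_mod[of ?d m]] by (simp add: r_def comp_def cong: bij_betw_cong)
  moreover have "real ?d * cyclic_point e u $ i = real (r i) + t" for i
  proof -
    have "r i < ?d" by (simp add: r_def)
    then have "real (r i) + 1 \<le> real ?d" by linarith
    then have lt: "(real (r i) + t) / real ?d < 1"
      using t by (simp add: field_simps)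
    have "real m + real (e i) = real ?d * real ((m + e i) div ?d) + real (r i)"
      unfolding r_def by (metis mult_div_mod_eq of_nat_add of_nat_mult)
    then have "u + real (e i) / real ?d - (real (r i) + t) / real ?d = real ((m + e i) div ?d)"
      using du by (simp add: field_simps)
    then have "u + real (e i) / real ?d - (real (r i) + t) / real ?d \<in> \<int>"
      by (metis Ints_of_nat)
    with lt t have "frac (u + real (e i) / real ?d) = (real (r i) + t) / real ?d"
      by (intro iffD2[OF frac_unique_iff]) auto
    then show ?thesis by (simp add: cyclic_point_def)
  qed
  ultimately show ?thesis using that t by blast
qed

lemma cyclic_point_measurable:
  "cyclic_point e \<in> unif \<rightarrow>\<^sub>M restrict_space borel (unit_cube :: (real ^ 'n::finite) set)"
proof (intro measurable_restrict_space2)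
  show "cyclic_point e \<in> space unif \<rightarrow> (unit_cube :: (real ^ 'n) set)"
    by (auto simp: cyclic_point_def unit_cube_def frac_lt_1 less_imp_le)
  have "cyclic_point e \<in> borel_measurable (borel :: real measure)"
    by (subst borel_measurable_euclidean_space)
       (auto simp: Basis_vec_def inner_axis cyclic_point_def)
  then show "cyclic_point e \<in> unif \<rightarrow>\<^sub>M (borel :: (real ^ 'n) measure)"
    by (intro measurable_restrict_space1) simp
qed

lemma coordinate_measurable:
  "(\<lambda>x. x $ i) \<in> restrict_space borel (unit_cube :: (real ^ 'n) set) \<rightarrow>\<^sub>M restrict_space borel {0..1}"
  by (intro measurable_restrict_space2 measurable_restrict_space1)
     (auto simp: unit_cube_def space_restrict_space)

lemma d_stochastic_cyclic:
  fixes e :: "'n::finite \<Rightarrow> nat"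
  assumes e: "\<And>i. e i < CARD('n)"
  shows "d_stochastic (distr unif (restrict_space borel unit_cube) (cyclic_point e))"
  unfolding d_stochastic_def
proof (intro conjI allI)
  show "prob_space (distr unif (restrict_space borel unit_cube) (cyclic_point e))"
    by (rule prob_space.prob_space_distr[OF prob_space_unif cyclic_point_measurable])
  fix i
  have "distr (distr unif (restrict_space borel unit_cube) (cyclic_point e))
          (restrict_space borel {0..1}) (\<lambda>x. x $ i)
      = distr unif (restrict_space borel {0..1}) (\<lambda>u. frac (u + real (e i) / real CARD('n)))"
    by (subst distr_distr[OF coordinate_measurable cyclic_point_measurable])
       (simp add: comp_def cyclic_point_def)
  also have "\<dots> = unif"
    using e[of i] by (intro distr_frac_shift) auto
  finally show "distr (distr unif (restrict_space borel unit_cube) (cyclic_point e))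
      (restrict_space borel {0..1}) (\<lambda>x. x $ i) = unif" .
qed simp

section \<open>Integrals against stochastic measures\<close>

lemma borel_measurable_potential [measurable]: "potential d \<in> borel_measurable borel"
  unfolding potential_def sq_interp_def by measurable

text \<open>A crude bound, for integrability only.\<close>

lemma abs_potential_le:
  assumes "d > 0" "0 \<le> x" "x \<le> 1"
  shows "\<bar>potential d x\<bar> \<le> 2 / real d * ((2 * real d + 1) * real d + real d * (real d + 1)) + 2 * real d"
proof -
  define y where "y = real d * x"
  define m where "m = real_of_int \<lfloor>y\<rfloor>"
  have y: "0 \<le> y" "y \<le> real d"
    using assms by (auto simp: y_def mult_left_le)
  have m: "0 \<le> m" "m \<le> real d"
    using y by (auto simp: m_def) linarith
  have "\<bar>sq_interp y\<bar> \<le> \<bar>(2 * m + 1) * y\<bar> + \<bar>m * (m + 1)\<bar>"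
    unfolding sq_interp_def m_def[symmetric] by (rule abs_triangle_ineq4)
  also have "\<dots> = (2 * m + 1) * y + m * (m + 1)" using m y by simp
  also have "\<dots> \<le> (2 * real d + 1) * real d + real d * (real d + 1)"
    using m y by (intro add_mono mult_mono) auto
  finally have "2 / real d * \<bar>sq_interp y\<bar> \<le> 2 / real d * ((2 * real d + 1) * real d + real d * (real d + 1))"
    by (intro mult_left_mono) auto
  moreover have "\<bar>potential d x\<bar> \<le> \<bar>2 / real d * sq_interp y\<bar> + \<bar>2 * y\<bar>"
    unfolding potential_def y_def[symmetric] using abs_triangle_ineq4[of "2 / real d * sq_interp y" "2 * y"]
    by (simp add: y_def mult.assoc)
  ultimately show ?thesis using y by (simp add: abs_mult)
qed

lemma d_stochastic_integral_coordinate: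
  fixes \<theta> :: "(real ^ 'n::finite) measure" and g :: "real \<Rightarrow> real"
  assumes \<theta>: "d_stochastic \<theta>" and g[measurable]: "g \<in> borel_measurable borel"
    and bound: "\<And>x. 0 \<le> x \<Longrightarrow> x \<le> 1 \<Longrightarrow> \<bar>g x\<bar> \<le> B"
  shows "integrable \<theta> (\<lambda>x. g (x $ i))"
    and "(\<integral>x. g (x $ i) \<partial>\<theta>) = (\<integral>u. g u \<partial>unif)"
proof -
  interpret prob_space \<theta> using \<theta> by (simp add: d_stochastic_def)
  have sets: "sets \<theta> = sets (restrict_space borel unit_cube)"
    and marg: "distr \<theta> (restrict_space borel {0..1}) (\<lambda>x. x $ i) = unif"
    using \<theta> by (auto simp: d_stochastic_def)
  have space: "space \<theta> = unit_cube"
    using sets_eq_imp_space_eq[OF sets] by (simp add: space_restrict_space)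
  have coord: "(\<lambda>x. x $ i) \<in> \<theta> \<rightarrow>\<^sub>M restrict_space borel {0..1}"
    using coordinate_measurable measurable_cong_sets[OF sets refl] by blast
  have g': "g \<in> borel_measurable (restrict_space borel {0..1})"
    by (rule measurable_restrict_space1[OF g])
  show "integrable \<theta> (\<lambda>x. g (x $ i))"
    by (rule integrable_const_bound[where B = B])
       (use bound measurable_compose[OF coord g'] in \<open>auto simp: space unit_cube_def\<close>)
  show "(\<integral>x. g (x $ i) \<partial>\<theta>) = (\<integral>u. g u \<partial>unif)"
    using integral_distr[OF coord g'] by (simp add: marg)
qed

text \<open>The value on the right does not depend on \<open>\<theta>\<close>; this is what makes the potential a dual
  certificate.\<close>

lemma d_stochastic_integral_potential:
  fixes \<theta> :: "(real ^ 'n::finite) measure"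
  assumes "d_stochastic \<theta>"
  shows "integrable \<theta> (\<lambda>x. (\<Sum>i\<in>UNIV. potential CARD('n) (x $ i)) + dual_const CARD('n))"
    and "(\<integral>x. (\<Sum>i\<in>UNIV. potential CARD('n) (x $ i)) + dual_const CARD('n) \<partial>\<theta>)
      = real CARD('n) * (\<integral>u. potential CARD('n) u \<partial>unif) + dual_const CARD('n)"
proof -
  interpret prob_space \<theta> using assms by (simp add: d_stochastic_def)
  note * = d_stochastic_integral_coordinate[OF assms borel_measurable_potential abs_potential_le[OF zero_less_card_finite[where 'a = 'n]]]
  show "integrable \<theta> (\<lambda>x. (\<Sum>i\<in>UNIV. potential CARD('n) (x $ i)) + dual_const CARD('n))"
    using * by auto
  show "(\<integral>x. (\<Sum>i\<in>UNIV. potential CARD('n) (x $ i)) + dual_const CARD('n) \<partial>\<theta>)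
      = real CARD('n) * (\<integral>u. potential CARD('n) u \<partial>unif) + dual_const CARD('n)"
    by (simp add: * prob_space)
qed

lemma borel_measurable_f_sum [measurable]: "(f_sum :: real ^ 'n \<Rightarrow> real) \<in> borel_measurable borel"
  unfolding f_sum_def by measurable

text \<open>Both integrands are constant along the cyclic coupling. The second equation determines the
  common integral of the potential for all stochastic measures without integrating it.\<close>

lemma integral_f_sum_cyclic:
  fixes e :: "'n::finite \<Rightarrow> nat"
  assumes e: "bij_betw e UNIV {..<CARD('n)}"
  defines "\<theta> \<equiv> distr unif (restrict_space borel unit_cube) (cyclic_point e)"
  shows "(\<integral>x. f_sum x \<partial>\<theta>) = ((real CARD('n))\<^sup>2 - 1) / 3"
    and "(\<integral>x. (\<Sum>i\<in>UNIV. potential CARD('n) (x $ i)) + dual_const CARD('n) \<partial>\<theta>) = ((real CARD('n))\<^sup>2 - 1) / 3"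
proof -
  interpret prob_space unif by (rule prob_space_unif)
  have eq: "f_sum (cyclic_point e u) = ((real CARD('n))\<^sup>2 - 1) / 3
      \<and> (\<Sum>i\<in>UNIV. potential CARD('n) (cyclic_point e u $ i)) + dual_const CARD('n) = ((real CARD('n))\<^sup>2 - 1) / 3"
    if "u \<in> space unif" for u
  proof -
    from that have "0 \<le> u" by (simp add: space_restrict_space)
    from cyclic_point_equispaced[OF e this] obtain r t where
      r: "bij_betw r UNIV {..<CARD('n)}" and t: "0 \<le> t" "t < 1"
      and x: "\<And>i. real CARD('n) * cyclic_point e u $ i = real (r i) + t" by metis
    have "\<lfloor>real CARD('n) * cyclic_point e u $ i\<rfloor> = int (r i)" for i
      unfolding x using t by (intro floor_unique) auto
    from f_sum_eq_potential[OF r this] f_sum_equispaced[OF r x] show ?thesis by simp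
  qed
  have int: "(\<integral>x. F x \<partial>\<theta>) = c"
    if F: "F \<in> borel_measurable borel" and c: "\<And>u. u \<in> space unif \<Longrightarrow> F (cyclic_point e u) = c"
    for F :: "real ^ 'n \<Rightarrow> real" and c
  proof -
    have "(\<integral>x. F x \<partial>\<theta>) = (\<integral>u. F (cyclic_point e u) \<partial>unif)"
      unfolding \<theta>_def by (rule integral_distr[OF cyclic_point_measurable measurable_restrict_space1[OF F]])
    also have "\<dots> = (\<integral>u. c \<partial>unif)"
      by (rule Bochner_Integration.integral_cong) (auto simp: c)
    also have "\<dots> = c"
      by (simp only: lebesgue_integral_const prob_space) simp
    finally show ?thesis .
  qed
  show "(\<integral>x. f_sum x \<partial>\<theta>) = ((real CARD('n))\<^sup>2 - 1) / 3"
    by (rule int) (use eq in auto)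
  show "(\<integral>x. (\<Sum>i\<in>UNIV. potential CARD('n) (x $ i)) + dual_const CARD('n) \<partial>\<theta>) = ((real CARD('n))\<^sup>2 - 1) / 3"
    by (rule int) (use eq in auto)
qed

section \<open>The value of the supremum\<close>

theorem theorem4p2:
  assumes "CARD('n::finite) \<ge> 2"
  shows "C (f_sum :: real ^ 'n \<Rightarrow> real) = ((real CARD('n))\<^sup>2 - 1) / 3"
proof -
  let ?c = "((real CARD('n))\<^sup>2 - 1) / 3"
  let ?G = "\<lambda>x :: real ^ 'n. (\<Sum>i\<in>UNIV. potential CARD('n) (x $ i)) + dual_const CARD('n)"
  obtain e :: "'n \<Rightarrow> nat" where e: "bij_betw e UNIV {..<CARD('n)}"
    using ex_bij_betw_finite_nat[of "UNIV :: 'n set"] by (auto simp: atLeast0LessThan)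
  define \<theta>0 :: "(real ^ 'n) measure"
    where "\<theta>0 = distr unif (restrict_space borel unit_cube) (cyclic_point e)"
  have "\<And>i. e i < CARD('n)" using e by (auto simp: bij_betw_def)
  then have \<theta>0: "d_stochastic \<theta>0" unfolding \<theta>0_def by (rule d_stochastic_cyclic)
  have upper: "(\<integral>x. f_sum x \<partial>\<theta>) \<le> ?c" if \<theta>: "d_stochastic \<theta>" for \<theta> :: "(real ^ 'n) measure"
  proof -
    have int: "integrable \<theta> ?G" by (rule d_stochastic_integral_potential[OF \<theta>])
    have sets: "sets \<theta> = sets (restrict_space borel unit_cube)"
      using \<theta> by (simp add: d_stochastic_def)
    have "integrable \<theta> f_sum"
    proof (rule Bochner_Integration.integrable_bound[OF int])
      show "f_sum \<in> borel_measurable \<theta>"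
        using measurable_cong_sets[OF sets refl] measurable_restrict_space1[OF borel_measurable_f_sum] by blast
      have "0 \<le> f_sum x" for x :: "real ^ 'n"
        by (auto simp: f_sum_def intro!: sum_nonneg)
      then show "AE x in \<theta>. norm (f_sum x) \<le> norm (?G x)"
        by (intro AE_I2) (metis abs_of_nonneg f_sum_le_potential order_trans real_norm_def)
    qed
    then have "(\<integral>x. f_sum x \<partial>\<theta>) \<le> (\<integral>x. ?G x \<partial>\<theta>)"
      by (intro integral_mono int f_sum_le_potential)
    also have "\<dots> = (\<integral>x. ?G x \<partial>\<theta>0)"
      using d_stochastic_integral_potential(2)[OF \<theta>] d_stochastic_integral_potential(2)[OF \<theta>0] by simp
    also have "\<dots> = ?c"
      unfolding \<theta>0_def by (rule integral_f_sum_cyclic(2)[OF e])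
    finally show ?thesis .
  qed
  have "(\<integral>x. f_sum x \<partial>\<theta>0) = ?c"
    unfolding \<theta>0_def by (rule integral_f_sum_cyclic(1)[OF e])
  with \<theta>0 upper show ?thesis
    unfolding C_def by (intro cSup_eq_maximum) (auto intro!: image_eqI[of _ _ \<theta>0])
qed

end
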